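(* Let $0<a<b<\pi$, put $T=\min\{a,\,b-a,\,\pi-b\}$, and let $G\in L_2(\mathbb R)$ be an arbitrary even non-trivial (not a.e. zero) function that equals zero outside the segment $[-T,T]$. Put $$s(t)=G(b-t),\qquad r(t)=-G(a-t).$$ Then $(-r,\,s+r)$ and $(-s-r,\,s)$ are distinct pairs of coefficients, and the choices $(p,q)=(-r,\,s+r)$ and $(p,q)=(-s-r,\,s)$ lead to the same pair of spectra $\big(\{\lambda_{n0}\}_{n\ge1},\{\lambda_{n1}\}_{n\ge1}\big)$ of the boundary value problems ${\mathcal L}_0(p,q)$ and ${\mathcal L}_1(p,q)$. Thus, for any $a,b$ with $0<a<b<\pi$, the inverse problem of recovering $p,q\in L_2(0,\pi)$ from the two spectra $\{\lambda_{n0}\}_{n\ge1}$ and $\{\lambda_{n1}\}_{n\ge1}$ has no unique solution.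
   Context: For complex-valued $p,q\in L_2(0,\pi)$ and $j\in\{0,1\}$, ${\mathcal L}_j(p,q)$ is the boundary value problem with two frozen arguments $a,b$ $$-y''(x)+p(x)y(a)+q(x)y(b)=\lambda y(x),\quad x\in(0,\pi),\qquad y^{(j)}(0)=y(\pi)=0,$$ with spectral parameter $\lambda\in\mathbb C$; here $y^{(0)}=y$, $y^{(1)}=y'$. Functions on $\mathbb R$ such as $s,r$ are used as coefficients by restriction to $(0,\pi)$ (here $s$ and $r$ vanish outside $[0,\pi]$). The spectrum $\{\lambda_{nj}\}_{n\ge1}$ is the sequence of eigenvalues, i.e. of the zeros, counted with multiplicity, of the characteristic function, which is the entire function of $\lambda=\rho^2$ $$\Delta_j(\lambda)=\left|\begin{array}{ccc} \varphi_j(\rho,\pi) & \int_0^\pi \frac{\sin\rho(\pi-t)}{\rho}p(t)\,dt & \int_0^\pi \frac{\sin\rho(\pi-t)}{\rho}q(t)\,dt\\ \varphi_j(\rho,a) & \int_0^a \frac{\sin\rho(a-t)}{\rho}p(t)\,dt-1 & \int_0^a \frac{\sin\rho(a-t)}{\rho}q(t)\,dt\\ \varphi_j(\rho,b) & \int_0^b \frac{\sin\rho(b-t)}{\rho}p(t)\,dt & \int_0^b \frac{\sin\rho(b-t)}{\rho}q(t)\,dt-1 \end{array}\right|,$$ where $\varphi_0(\rho,z)=\rho^{-1}\sin\rho z$ and $\varphi_1(\rho,z)=\cos\rho z$ (values at $\rho=0$ are understood by continuity). *)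

theory Defs
  imports "HOL-Complex_Analysis.Complex_Analysis"
begin

definition L2_on :: "real set \<Rightarrow> (real \<Rightarrow> complex) \<Rightarrow> bool" where
  "L2_on S f \<longleftrightarrow> set_borel_measurable lebesgue S f
     \<and> set_integrable lebesgue S (\<lambda>t. (norm (f t))\<^sup>2)"

(* Equality of two coefficient pairs as pairs of elements of L_2(0,pi). *)
definition same_coeffs ::
  "(real \<Rightarrow> complex) \<times> (real \<Rightarrow> complex) \<Rightarrow> (real \<Rightarrow> complex) \<times> (real \<Rightarrow> complex) \<Rightarrow> bool" where
  "same_coeffs u v \<longleftrightarrow>
     (AE t in lebesgue. t \<in> {0<..<pi} \<longrightarrow> fst u t = fst v t \<and> snd u t = snd v t)"

(* sin (rho z) / rho, extended by continuity to rho = 0. *)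
definition sin_quot :: "complex \<Rightarrow> real \<Rightarrow> complex" where
  "sin_quot \<rho> z = (if \<rho> = 0 then of_real z else sin (\<rho> * of_real z) / \<rho>)"

definition phi :: "nat \<Rightarrow> complex \<Rightarrow> real \<Rightarrow> complex" where
  "phi j \<rho> z = (if j = 0 then sin_quot \<rho> z else cos (\<rho> * of_real z))"

definition sin_int :: "(real \<Rightarrow> complex) \<Rightarrow> complex \<Rightarrow> real \<Rightarrow> complex" where
  "sin_int f \<rho> z = (LINT t:{0..z}|lebesgue. sin_quot \<rho> (z - t) * f t)"

definition char_det ::
  "nat \<Rightarrow> real \<Rightarrow> real \<Rightarrow> (real \<Rightarrow> complex) \<Rightarrow> (real \<Rightarrow> complex) \<Rightarrow> complex \<Rightarrow> complex" where
  "char_det j a b p q \<rho> = det (vector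
     [vector [phi j \<rho> pi, sin_int p \<rho> pi,    sin_int q \<rho> pi],
      vector [phi j \<rho> a,  sin_int p \<rho> a - 1, sin_int q \<rho> a],
      vector [phi j \<rho> b,  sin_int p \<rho> b,     sin_int q \<rho> b - 1]] :: complex ^ 3 ^ 3)"

(* The determinant is even in rho, so the branch of the square root is immaterial. *)
definition Delta ::
  "nat \<Rightarrow> real \<Rightarrow> real \<Rightarrow> (real \<Rightarrow> complex) \<Rightarrow> (real \<Rightarrow> complex) \<Rightarrow> complex \<Rightarrow> complex" where
  "Delta j a b p q lam = char_det j a b p q (csqrt lam)"

(* The spectrum as a multiset of complex numbers (infinite, hence given by its multiplicity
   function): it records the sequence of eigenvalues up to the order of its terms.
   For p, q in L_2(0,pi) Delta is entire and not identically zero, so zorder is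
   the multiplicity of a zero. *)
definition spectrum ::
  "nat \<Rightarrow> real \<Rightarrow> real \<Rightarrow> (real \<Rightarrow> complex) \<times> (real \<Rightarrow> complex) \<Rightarrow> complex \<Rightarrow> nat" where
  "spectrum j a b u lam =
     (let f = Delta j a b (fst u) (snd u) in if f lam = 0 then nat (zorder f lam) else 0)"

definition spectra ::
  "real \<Rightarrow> real \<Rightarrow> (real \<Rightarrow> complex) \<times> (real \<Rightarrow> complex) \<Rightarrow> (complex \<Rightarrow> nat) \<times> (complex \<Rightarrow> nat)" where
  "spectra a b u = (spectrum 0 a b u, spectrum 1 a b u)"

definition coeff_pairs :: "((real \<Rightarrow> complex) \<times> (real \<Rightarrow> complex)) set" where
  "coeff_pairs = {(p, q). L2_on {0<..<pi} p \<and> L2_on {0<..<pi} q}"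

definition uniquely_solvable :: "real \<Rightarrow> real \<Rightarrow> bool" where
  "uniquely_solvable a b \<longleftrightarrow>
     (\<forall>u\<in>coeff_pairs. \<forall>v\<in>coeff_pairs. spectra a b u = spectra a b v \<longrightarrow> same_coeffs u v)"

end

theory Submission
  imports Defs
begin

text \<open>
  Write \<open>R\<close> and \<open>S\<close> for the functions \<open>z \<mapsto> \<integral>\<^sub>0\<^sup>z sin \<rho>(z - t)/\<rho> f(t) dt\<close> with \<open>f = r\<close> and \<open>f = s\<close>.
  By multilinearity of the determinant, nearly everything cancels in the difference of the
  characteristic functions of \<open>(-r, s + r)\<close> and \<open>(-s - r, s)\<close>: adding the second column to
  the third in the former and the third to the second in the latter leaves
  \<open>\<phi>(a) S(\<pi>) - \<phi>(\<pi>) (S(a) + R(b)) + \<phi>(b) R(\<pi>)\<close>.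

  The function \<open>s\<close> is an even function moved to the centre \<open>b\<close>, and \<open>r\<close> is its negative moved to \<open>a\<close>.
  If the support of \<open>G(c - t)\<close> lies in \<open>[0, z]\<close>, then averaging over the two
  signs of \<open>\<tau> = c - t\<close> and \<open>sin(x + y) + sin(x - y) = 2 sin x cos y\<close> show that its integral against
  \<open>sin \<rho>(z - t)/\<rho>\<close> equals \<open>C sin \<rho>(z - c)/\<rho>\<close>, where \<open>C = \<integral> cos(\<rho>\<tau>) G(\<tau>) d\<tau>\<close> depends neither
  on \<open>c\<close> nor on \<open>z\<close> (lemma \<open>sin_int_reflected_even\<close>). The choice of \<open>T\<close> puts the support of \<open>s\<close> into
  \<open>[a, \<pi>]\<close> and that of \<open>r\<close> into \<open>[0, b]\<close>. Hence \<open>S(a) = 0\<close>, the values \<open>S(\<pi>)\<close>, \<open>R(b)\<close>, \<open>R(\<pi>)\<close> are given by this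
  formula, and the difference of the characteristic functions is \<open>C\<close> times
  \<open>\<phi>(a) sin \<rho>(\<pi> - b)/\<rho> + \<phi>(\<pi>) sin \<rho>(b - a)/\<rho> - \<phi>(b) sin \<rho>(\<pi> - a)/\<rho>\<close>. This is zero because
  \<open>\<phi>\<close> solves \<open>y'' + \<rho>\<^sup>2y = 0\<close>, so that its values at any three points satisfy this linear
  relation (lemma \<open>phi_three_point\<close>). So the
  characteristic functions, and with them the multiplicities of their zeros, are identical.

  The pairs differ because their first entries differ by \<open>s\<close>, a translate of the non-trivial \<open>G\<close> with
  support in \<open>[0, \<pi>]\<close>. Since \<open>T > 0\<close>, the indicator function of \<open>[-T, T]\<close> is an admissible \<open>G\<close>, so
  uniqueness fails for all \<open>0 < a < b < \<pi>\<close>.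
\<close>

section \<open>Reflections of the line\<close>

lemma measurable_lebesgue_reflect [measurable]:
  "(\<lambda>t::real. c - t) \<in> lebesgue \<rightarrow>\<^sub>M lebesgue"
  using lebesgue_affine_measurable[of "\<lambda>_::real. - 1" c] by simp

lemma distr_lebesgue_reflect: "distr lebesgue lebesgue (\<lambda>t::real. c - t) = lebesgue"
  using lebesgue_real_affine[of "- 1" c] by (simp add: density_1)

lemma AE_lebesgue_reflect:
  assumes "AE t::real in lebesgue. P t"
  shows "AE t in lebesgue. P (c - t)"
  using assms by (intro AE_distrD[OF measurable_lebesgue_reflect]) (simp only: distr_lebesgue_reflect)

lemma integrable_lebesgue_reflect:
  fixes f :: "real \<Rightarrow> 'a::{banach, second_countable_topology}"
  assumes "integrable lebesgue f"
  shows "integrable lebesgue (\<lambda>t. f (c - t))"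
  using assms by (intro integrable_distr[OF measurable_lebesgue_reflect]) (simp only: distr_lebesgue_reflect)

lemma integral_lebesgue_reflect:
  fixes f :: "real \<Rightarrow> 'a::{banach, second_countable_topology}"
  assumes "f \<in> borel_measurable lebesgue"
  shows "(LINT t|lebesgue. f (c - t)) = (LINT t|lebesgue. f t)"
  using integral_distr[OF measurable_lebesgue_reflect assms, of c]
  by (simp only: distr_lebesgue_reflect)

lemma AE_lebesgue_neq: "AE t::real in lebesgue. t \<noteq> c"
  by (rule AE_completion[OF AE_lborel_singleton])

section \<open>Square integrable coefficients\<close>

lemma L2_on_UNIV_iff:
  "L2_on UNIV f \<longleftrightarrow> f \<in> borel_measurable lebesgue \<and> integrable lebesgue (\<lambda>t. (norm (f t))\<^sup>2)"
  by (simp add: L2_on_def set_borel_measurable_def set_integrable_def)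

lemma L2_on_UNIV_subset:
  assumes "L2_on UNIV f" and "S \<in> sets lebesgue"
  shows "L2_on S f"
proof -
  have "set_integrable lebesgue S (\<lambda>t. (norm (f t))\<^sup>2)"
    using assms set_integrable_subset[of lebesgue UNIV "\<lambda>t. (norm (f t))\<^sup>2" S] by (simp add: L2_on_def)
  moreover have "f \<in> borel_measurable lebesgue"
    using assms by (simp add: L2_on_UNIV_iff)
  ultimately show ?thesis
    using assms(2) by (simp add: L2_on_def set_borel_measurable_def)
qed

lemma L2_on_UNIV_reflect:
  assumes "L2_on UNIV f"
  shows "L2_on UNIV (\<lambda>t. f (c - t))"
  using assms integrable_lebesgue_reflect[of "\<lambda>t. (norm (f t))\<^sup>2" c]
    measurable_compose[OF measurable_lebesgue_reflect, of f borel c]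
  by (simp add: L2_on_UNIV_iff)

lemma L2_on_UNIV_uminus: "L2_on UNIV f \<Longrightarrow> L2_on UNIV (\<lambda>t. - f t)"
  by (simp add: L2_on_UNIV_iff)

lemma L2_on_UNIV_add:
  assumes "L2_on UNIV f" and "L2_on UNIV g"
  shows "L2_on UNIV (\<lambda>t. f t + g t)"
proof -
  have [measurable]: "f \<in> borel_measurable lebesgue" "g \<in> borel_measurable lebesgue"
    using assms by (auto simp: L2_on_UNIV_iff)
  have "integrable lebesgue (\<lambda>t. (norm (f t + g t))\<^sup>2)"
  proof (rule Bochner_Integration.integrable_bound)
    show "integrable lebesgue (\<lambda>t. 2 * (norm (f t))\<^sup>2 + 2 * (norm (g t))\<^sup>2)"
      using assms by (auto simp: L2_on_UNIV_iff)
    have "(norm (x + y))\<^sup>2 \<le> 2 * (norm x)\<^sup>2 + 2 * (norm y)\<^sup>2" for x y :: complex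
    proof -
      have "(norm (x + y))\<^sup>2 \<le> (norm x + norm y)\<^sup>2"
        by (intro power_mono norm_triangle_ineq) auto
      also have "\<dots> \<le> 2 * (norm x)\<^sup>2 + 2 * (norm y)\<^sup>2"
        using zero_le_power2[of "norm x - norm y"] by (simp add: power2_eq_square algebra_simps)
      finally show ?thesis .
    qed
    then show "AE t in lebesgue. norm ((norm (f t + g t))\<^sup>2)
        \<le> norm (2 * (norm (f t))\<^sup>2 + 2 * (norm (g t))\<^sup>2)"
      by (intro AE_I2) (simp add: abs_of_nonneg)
  qed measurable
  then show ?thesis
    by (simp add: L2_on_UNIV_iff)
qed

lemma integrable_of_L2_bounded_support:
  fixes l u :: real
  assumes "L2_on UNIV f" and "AE t in lebesgue. t \<notin> {l..u} \<longrightarrow> f t = 0"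
  shows "integrable lebesgue f"
proof (rule Bochner_Integration.integrable_bound)
  have "integrable lebesgue (indicat_real {l..u})"
    by (simp add: integrable_indicator_iff emeasure_lborel_Icc_eq)
  then show "integrable lebesgue (\<lambda>t. indicat_real {l..u} t + (norm (f t))\<^sup>2)"
    using assms(1) by (simp add: L2_on_UNIV_iff)
  show "f \<in> borel_measurable lebesgue"
    using assms(1) by (simp add: L2_on_UNIV_iff)
  have "x \<le> 1 + x\<^sup>2" for x :: real
    using zero_le_power2[of "x - 1 / 2"] by (simp add: power2_eq_square algebra_simps)
  then show "AE t in lebesgue. norm (f t) \<le> norm (indicat_real {l..u} t + (norm (f t))\<^sup>2)"
    using assms(2) by (auto elim!: eventually_mono simp: indicator_def)
qed

text \<open>The multiplier is bounded only on the support; \<open>cos (\<rho> t)\<close> with non-real \<open>\<rho>\<close> is unbounded on the line.\<close>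

lemma integrable_continuous_mult:
  fixes f h :: "real \<Rightarrow> complex" and l u :: real
  assumes f: "integrable lebesgue f" and supp: "AE t in lebesgue. t \<notin> {l..u} \<longrightarrow> f t = 0"
    and h: "continuous_on UNIV h"
  shows "integrable lebesgue (\<lambda>t. h t * f t)"
proof -
  have "compact (h ` {l..u})"
    using h by (intro compact_continuous_image) (auto intro: continuous_on_subset)
  then obtain K where K: "\<And>t. t \<in> {l..u} \<Longrightarrow> norm (h t) \<le> K"
    by (metis compact_imp_bounded bounded_iff image_eqI)
  have [measurable]: "h \<in> borel_measurable lebesgue"
    using borel_measurable_continuous_onI[OF h] by (simp add: measurable_completion)
  have [measurable]: "f \<in> borel_measurable lebesgue"
    using f by simp
  show ?thesis
  proof (rule Bochner_Integration.integrable_bound)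
    show "integrable lebesgue (\<lambda>t. of_real K * f t)"
      using f by simp
    show "AE t in lebesgue. norm (h t * f t) \<le> norm (of_real K * f t)"
      using supp
    proof (eventually_elim, goal_cases)
      case (1 t)
      then show ?case
        using K[of t] by (cases "t \<in> {l..u}") (auto simp: norm_mult intro!: mult_right_mono)
    qed
  qed measurable
qed

section \<open>Trigonometric identities\<close>

lemma continuous_on_sin_quot [continuous_intros]:
  fixes g :: "real \<Rightarrow> real"
  assumes "continuous_on A g"
  shows "continuous_on A (\<lambda>t. sin_quot \<rho> (g t))"
  unfolding sin_quot_def using assms
  by (cases "\<rho> = 0") (auto intro!: continuous_intros)

lemma sin_quot_add_diff:
  "sin_quot \<rho> (x + y) + sin_quot \<rho> (x - y) = 2 * sin_quot \<rho> x * cos (\<rho> * of_real y)"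
  by (cases "\<rho> = 0")
     (simp_all add: sin_quot_def distrib_left right_diff_distrib sin_add sin_diff field_simps)

text \<open>Solutions of \<open>y'' + \<rho>\<^sup>2y = 0\<close> form a plane, so their values at three points obey a linear relation;
  its coefficients are read off from the solutions \<open>sin \<rho>(z - x)/\<rho>\<close>.\<close>

lemma phi_three_point:
  "phi j \<rho> x * sin_quot \<rho> (z - y) + phi j \<rho> z * sin_quot \<rho> (y - x) = phi j \<rho> y * sin_quot \<rho> (z - x)"
proof -
  have s: "sin X * sin (Z - Y) + sin Z * sin (Y - X) = sin Y * sin (Z - X)"
    and c: "cos X * sin (Z - Y) + cos Z * sin (Y - X) = cos Y * sin (Z - X)" for X Y Z :: complex
    by (simp_all add: sin_diff algebra_simps)
  show ?thesis
  proof (cases "\<rho> = 0")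
    case True
    then show ?thesis
      by (simp add: phi_def sin_quot_def algebra_simps)
  next
    case False
    then show ?thesis
      using s[of "\<rho> * x" "\<rho> * z" "\<rho> * y"] c[of "\<rho> * x" "\<rho> * z" "\<rho> * y"]
      by (simp add: phi_def sin_quot_def right_diff_distrib flip: add_divide_distrib)
  qed
qed

section \<open>Sine integrals of a translated even function\<close>

lemma sin_int_uminus: "sin_int (\<lambda>t. - f t) \<rho> z = - sin_int f \<rho> z"
  by (simp add: sin_int_def set_lebesgue_integral_def)

lemma sin_int_add:
  assumes "integrable lebesgue f" and "AE t in lebesgue. t \<notin> {l..u} \<longrightarrow> f t = 0"
    and "integrable lebesgue g" and "AE t in lebesgue. t \<notin> {l'..u'} \<longrightarrow> g t = 0"
  shows "sin_int (\<lambda>t. f t + g t) \<rho> z = sin_int f \<rho> z + sin_int g \<rho> z"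
proof -
  have "set_integrable lebesgue {0..z} (\<lambda>t. sin_quot \<rho> (z - t) * h t)"
    if "integrable lebesgue h" "AE t in lebesgue. t \<notin> {l..u} \<longrightarrow> h t = 0" for h l u
    unfolding set_integrable_def
    by (intro integrable_mult_indicator integrable_continuous_mult[OF that])
       (auto intro!: continuous_intros)
  from this[OF assms(1,2)] this[OF assms(3,4)] show ?thesis
    by (simp add: sin_int_def distrib_left)
qed

lemma sin_int_eq_0:
  assumes "AE t in lebesgue. t \<notin> {l..u} \<longrightarrow> f t = 0" and "z \<le> l"
  shows "sin_int f \<rho> z = 0"
proof -
  \<comment> \<open>The intervals may share the end point \<open>l\<close>, which is a null set.\<close>
  have "AE t in lebesgue. indicat_real {0..z} t *\<^sub>R (sin_quot \<rho> (z - t) * f t) = 0"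
    using assms(1) AE_lebesgue_neq[of l]
    by eventually_elim (use assms(2) in \<open>auto simp: indicator_def\<close>)
  then show ?thesis
    unfolding sin_int_def set_lebesgue_integral_def by (rule integral_eq_zero_AE)
qed

lemma support_reflect:
  fixes G :: "real \<Rightarrow> complex"
  assumes "AE t in lebesgue. t \<notin> {- T..T} \<longrightarrow> G t = 0"
  shows "AE t in lebesgue. t \<notin> {c - T..c + T} \<longrightarrow> G (c - t) = 0"
  using AE_lebesgue_reflect[OF assms, of c] by eventually_elim auto

text \<open>The integral against an even function sees only the even part in \<open>\<tau>\<close> of
  \<open>sin \<rho>(z - c + \<tau>)/\<rho>\<close>, and there the variables separate.\<close>

lemma sin_int_reflected_even:
  assumes G: "integrable lebesgue G" and even: "AE t in lebesgue. G (- t) = G t"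
    and supp: "AE t in lebesgue. t \<notin> {- T..T} \<longrightarrow> G t = 0"
    and "0 \<le> c - T" and "c + T \<le> z"
  shows "sin_int (\<lambda>t. G (c - t)) \<rho> z
    = sin_quot \<rho> (z - c) * (LINT t|lebesgue. cos (\<rho> * of_real t) * G t)"
proof -
  define x where "x = z - c"
  have int: "integrable lebesgue (\<lambda>t. h t * G t)" if "continuous_on UNIV h" for h
    by (rule integrable_continuous_mult[OF G supp that])
  have int_plus: "integrable lebesgue (\<lambda>t. sin_quot \<rho> (x + t) * G t)"
    and int_minus: "integrable lebesgue (\<lambda>t. sin_quot \<rho> (x - t) * G t)"
    by (auto intro!: int continuous_intros)
  have int_minus': "integrable lebesgue (\<lambda>t. sin_quot \<rho> (x - t) * G (- t))"
    using integrable_lebesgue_reflect[OF int_plus, of 0] by simp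
  have "sin_int (\<lambda>t. G (c - t)) \<rho> z = (LINT t|lebesgue. sin_quot \<rho> (x + (c - t)) * G (c - t))"
    unfolding sin_int_def set_lebesgue_integral_def
  proof (rule integral_cong_AE)
    have shift: "z - t = x + (c - t)" for t
      by (simp add: x_def)
    have m: "(\<lambda>t. sin_quot \<rho> (x + (c - t)) * G (c - t)) \<in> borel_measurable lebesgue"
      using integrable_lebesgue_reflect[OF int_plus, of c] by simp
    then show "(\<lambda>t. sin_quot \<rho> (x + (c - t)) * G (c - t)) \<in> borel_measurable lebesgue" .
    show "(\<lambda>t. indicat_real {0..z} t *\<^sub>R (sin_quot \<rho> (z - t) * G (c - t)))
        \<in> borel_measurable lebesgue"
      unfolding shift using m by (intro borel_measurable_scaleR borel_measurable_indicator) auto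
    show "AE t in lebesgue. indicat_real {0..z} t *\<^sub>R (sin_quot \<rho> (z - t) * G (c - t))
        = sin_quot \<rho> (x + (c - t)) * G (c - t)"
      using support_reflect[OF supp, of c]
      by eventually_elim (use assms(4,5) in \<open>auto simp: indicator_def x_def\<close>)
  qed
  also have "\<dots> = (LINT t|lebesgue. sin_quot \<rho> (x + t) * G t)"
    by (rule integral_lebesgue_reflect) (use int_plus in simp)
  finally have eq: "sin_int (\<lambda>t. G (c - t)) \<rho> z = (LINT t|lebesgue. sin_quot \<rho> (x + t) * G t)" .
  have "(LINT t|lebesgue. sin_quot \<rho> (x + t) * G t)
      = (LINT t|lebesgue. sin_quot \<rho> (x - t) * G (- t))"
    using integral_lebesgue_reflect[of "\<lambda>t. sin_quot \<rho> (x + t) * G t" 0] int_plus by simp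
  also have "\<dots> = (LINT t|lebesgue. sin_quot \<rho> (x - t) * G t)"
    using int_minus int_minus' even
    by (intro integral_cong_AE) (auto elim!: eventually_mono)
  finally have "2 * (LINT t|lebesgue. sin_quot \<rho> (x + t) * G t)
      = (LINT t|lebesgue. sin_quot \<rho> (x + t) * G t + sin_quot \<rho> (x - t) * G t)"
    using int_plus int_minus by simp
  also have "\<dots> = (LINT t|lebesgue. 2 * sin_quot \<rho> x * (cos (\<rho> * of_real t) * G t))"
    by (simp add: mult.assoc sin_quot_add_diff flip: distrib_right)
  also have "\<dots> = 2 * sin_quot \<rho> x * (LINT t|lebesgue. cos (\<rho> * of_real t) * G t)"
    by simp
  finally show ?thesis
    by (simp add: eq x_def)
qed

section \<open>The two coefficient pairs\<close>

lemma char_det_expand: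
  "char_det j a b p q \<rho> =
     phi j \<rho> pi * ((sin_int p \<rho> a - 1) * (sin_int q \<rho> b - 1) - sin_int q \<rho> a * sin_int p \<rho> b)
   - phi j \<rho> a * (sin_int p \<rho> pi * (sin_int q \<rho> b - 1) - sin_int q \<rho> pi * sin_int p \<rho> b)
   + phi j \<rho> b * (sin_int p \<rho> pi * sin_int q \<rho> a - sin_int q \<rho> pi * (sin_int p \<rho> a - 1))"
  by (simp add: char_det_def det_3 algebra_simps)

lemma char_det_eq:
  fixes a b T :: real and G :: "real \<Rightarrow> complex"
  assumes T: "T \<le> a" "T \<le> b - a" "T \<le> pi - b" and "0 < a" "a < b" "b < pi"
    and G: "integrable lebesgue G" and even: "AE t in lebesgue. G (- t) = G t"
    and supp: "AE t in lebesgue. t \<notin> {- T..T} \<longrightarrow> G t = 0"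
  defines "s \<equiv> (\<lambda>t. G (b - t))" and "r \<equiv> (\<lambda>t. - G (a - t))"
  shows "char_det j a b (\<lambda>t. - r t) (\<lambda>t. s t + r t) \<rho> = char_det j a b (\<lambda>t. - s t - r t) s \<rho>"
proof -
  define C where "C = (LINT t|lebesgue. cos (\<rho> * of_real t) * G t)"
  define R where "R = sin_int r \<rho>"
  define S where "S = sin_int s \<rho>"
  have supp_s: "AE t in lebesgue. t \<notin> {b - T..b + T} \<longrightarrow> s t = 0"
    unfolding s_def by (rule support_reflect[OF supp])
  have supp_r: "AE t in lebesgue. t \<notin> {a - T..a + T} \<longrightarrow> r t = 0"
    unfolding r_def using support_reflect[OF supp] by simp
  have int: "integrable lebesgue s" "integrable lebesgue r"
    unfolding s_def r_def using integrable_lebesgue_reflect[OF G] by auto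
  have sum: "sin_int (\<lambda>t. s t + r t) \<rho> z = S z + R z" for z
    unfolding S_def R_def by (rule sin_int_add[OF int(1) supp_s int(2) supp_r])
  have minus_sum: "sin_int (\<lambda>t. - s t - r t) \<rho> z = - S z - R z" for z
    using sin_int_uminus[of "\<lambda>t. s t + r t" \<rho> z] by (simp add: sum)
  have minus: "sin_int (\<lambda>t. - r t) \<rho> z = - R z" for z
    by (simp add: R_def sin_int_uminus)
  have Sa: "S a = 0"
    unfolding S_def by (rule sin_int_eq_0[OF supp_s]) (use T in simp)
  have Spi: "S pi = sin_quot \<rho> (pi - b) * C"
    unfolding S_def C_def s_def
    by (rule sin_int_reflected_even[OF G even supp]) (use assms(1-6) in auto)
  have R: "R z = - sin_quot \<rho> (z - a) * C" if "z \<ge> b" for z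
    unfolding R_def C_def r_def sin_int_uminus
    by (subst sin_int_reflected_even[OF G even supp]) (use assms(1-6) that in auto)
  have "char_det j a b (\<lambda>t. - r t) (\<lambda>t. s t + r t) \<rho> - char_det j a b (\<lambda>t. - s t - r t) s \<rho>
      = phi j \<rho> a * S pi - phi j \<rho> pi * (S a + R b) + phi j \<rho> b * R pi"
    unfolding char_det_expand sum minus_sum minus S_def[symmetric] by algebra
  also have "\<dots> = C * (phi j \<rho> a * sin_quot \<rho> (pi - b) + phi j \<rho> pi * sin_quot \<rho> (b - a)
      - phi j \<rho> b * sin_quot \<rho> (pi - a))"
    using \<open>b < pi\<close> by (simp add: Sa Spi R algebra_simps)
  also have "\<dots> = 0"
    by (simp add: phi_three_point)
  finally show ?thesis
    by simp
qed

lemma not_same_coeffs_reflected: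
  fixes a b T :: real and G :: "real \<Rightarrow> complex"
  assumes "T \<le> b" "T \<le> pi - b" and nontrivial: "\<not> (AE t in lebesgue. G t = 0)"
    and supp: "AE t in lebesgue. t \<notin> {- T..T} \<longrightarrow> G t = 0"
  defines "s \<equiv> (\<lambda>t. G (b - t))"
  shows "\<not> same_coeffs (\<lambda>t. - r t, q) (\<lambda>t. - s t - r t, q')"
proof
  assume "same_coeffs (\<lambda>t. - r t, q) (\<lambda>t. - s t - r t, q')"
  then have "AE t in lebesgue. t \<in> {0<..<pi} \<longrightarrow> s t = 0"
    by (auto simp: same_coeffs_def elim!: eventually_mono)
  moreover have "AE t in lebesgue. t \<notin> {b - T..b + T} \<longrightarrow> s t = 0"
    unfolding s_def by (rule support_reflect[OF supp])
  ultimately have "AE t in lebesgue. s t = 0"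
    using AE_lebesgue_neq[of 0] AE_lebesgue_neq[of pi]
    by eventually_elim (use assms(1,2) in force)
  from AE_lebesgue_reflect[OF this, of b] nontrivial show False
    by (simp add: s_def)
qed

theorem theorem3p1:
  fixes a b :: real
  assumes "0 < a" and "a < b" and "b < pi"
  shows "(\<forall>(G :: real \<Rightarrow> complex) T s r.
            T = Min {a, b - a, pi - b} \<longrightarrow>
            L2_on UNIV G \<longrightarrow>
            (AE t in lebesgue. G (- t) = G t) \<longrightarrow>
            \<not> (AE t in lebesgue. G t = 0) \<longrightarrow>
            (AE t in lebesgue. t \<notin> {- T..T} \<longrightarrow> G t = 0) \<longrightarrow>
            s = (\<lambda>t. G (b - t)) \<longrightarrow>
            r = (\<lambda>t. - G (a - t)) \<longrightarrow>
            (let u = (\<lambda>t. - r t, \<lambda>t. s t + r t); v = (\<lambda>t. - s t - r t, s)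
             in u \<in> coeff_pairs \<and> v \<in> coeff_pairs \<and> \<not> same_coeffs u v
                \<and> spectra a b u = spectra a b v))
         \<and> \<not> uniquely_solvable a b"
proof (rule conjI)
  let ?claim = "\<lambda>G T s r. T = Min {a, b - a, pi - b} \<longrightarrow> L2_on UNIV G \<longrightarrow>
      (AE t in lebesgue. G (- t) = G t) \<longrightarrow> \<not> (AE t in lebesgue. G t = 0) \<longrightarrow>
      (AE t in lebesgue. t \<notin> {- T..T} \<longrightarrow> G t = 0) \<longrightarrow>
      s = (\<lambda>t. G (b - t)) \<longrightarrow> r = (\<lambda>t. - G (a - t)) \<longrightarrow>
      (let u = (\<lambda>t. - r t, \<lambda>t. s t + r t); v = (\<lambda>t. - s t - r t, s)
       in u \<in> coeff_pairs \<and> v \<in> coeff_pairs \<and> \<not> same_coeffs u v \<and> spectra a b u = spectra a b v)"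
  show same: "\<forall>(G :: real \<Rightarrow> complex) T s r. ?claim G T s r"
  proof (intro allI impI)
    fix G :: "real \<Rightarrow> complex" and T s r
    assume T: "T = Min {a, b - a, pi - b}" and L2: "L2_on UNIV G"
      and even: "AE t in lebesgue. G (- t) = G t"
      and nontrivial: "\<not> (AE t in lebesgue. G t = 0)"
      and supp: "AE t in lebesgue. t \<notin> {- T..T} \<longrightarrow> G t = 0"
      and s: "s = (\<lambda>t. G (b - t))" and r: "r = (\<lambda>t. - G (a - t))"
    have T_le: "T \<le> a" "T \<le> b - a" "T \<le> pi - b" "T \<le> b"
      using assms by (auto simp: T)
    have L2_s: "L2_on UNIV s" and L2_r: "L2_on UNIV r"
      unfolding s r by (intro L2_on_UNIV_uminus L2_on_UNIV_reflect L2)+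
    have L2_sum: "L2_on UNIV (\<lambda>t. s t + r t)"
      by (rule L2_on_UNIV_add[OF L2_s L2_r])
    have L2_minus_sum: "L2_on UNIV (\<lambda>t. - s t - r t)"
      using L2_on_UNIV_uminus[OF L2_sum] by simp
    have "(\<lambda>t. - r t, \<lambda>t. s t + r t) \<in> coeff_pairs" "(\<lambda>t. - s t - r t, s) \<in> coeff_pairs"
      using L2_on_UNIV_uminus[OF L2_r] L2_s L2_sum L2_minus_sum
      by (auto simp: coeff_pairs_def intro!: L2_on_UNIV_subset)
    moreover have "\<not> same_coeffs (\<lambda>t. - r t, \<lambda>t. s t + r t) (\<lambda>t. - s t - r t, s)"
      using not_same_coeffs_reflected[OF T_le(4,3) nontrivial supp] by (simp add: s)
    moreover have "Delta j a b (\<lambda>t. - r t) (\<lambda>t. s t + r t) = Delta j a b (\<lambda>t. - s t - r t) s" for j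
      unfolding Delta_def s r
      by (intro ext char_det_eq[OF T_le(1-3) assms] even supp integrable_of_L2_bounded_support[OF L2 supp])
    then have "spectra a b (\<lambda>t. - r t, \<lambda>t. s t + r t) = spectra a b (\<lambda>t. - s t - r t, s)"
      by (auto simp: spectra_def spectrum_def)
    ultimately show "let u = (\<lambda>t. - r t, \<lambda>t. s t + r t); v = (\<lambda>t. - s t - r t, s)
       in u \<in> coeff_pairs \<and> v \<in> coeff_pairs \<and> \<not> same_coeffs u v \<and> spectra a b u = spectra a b v"
      by (simp add: Let_def)
  qed
  show "\<not> uniquely_solvable a b"
  proof -
    define T where "T = Min {a, b - a, pi - b}"
    define G :: "real \<Rightarrow> complex" where "G = indicator {- T..T}"
    have "T > 0"
      using assms by (simp add: T_def)
    have int: "integrable lebesgue (indicat_real {- T..T})"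
      by (simp add: integrable_indicator_iff emeasure_lborel_Icc_eq)
    have "(\<lambda>t. (norm (G t))\<^sup>2) = indicat_real {- T..T}"
      by (auto simp: G_def indicator_def)
    with int have "L2_on UNIV G"
      by (simp add: L2_on_UNIV_iff) (simp add: G_def borel_measurable_indicator)
    moreover have "G (- t) = G t" for t
      by (auto simp: G_def indicator_def)
    moreover have "\<not> (AE t in lebesgue. G t = 0)"
    proof
      assume "AE t in lebesgue. G t = 0"
      then have "AE t in lebesgue. t \<notin> {- T..T}"
        by (auto elim!: eventually_mono simp: G_def indicator_def split: if_splits)
      then have "emeasure lebesgue {- T..T} = 0"
        using AE_iff_measurable[of "{- T..T}" lebesgue "\<lambda>t. t \<notin> {- T..T}"]
        by (simp del: atLeastAtMost_iff)
      with \<open>T > 0\<close> show False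
        by simp
    qed
    moreover have "AE t in lebesgue. t \<notin> {- T..T} \<longrightarrow> G t = 0"
      by (simp add: G_def)
    ultimately show ?thesis
      using same[rule_format, OF T_def _ _ _ _ refl refl, of G]
      by (auto simp: uniquely_solvable_def Let_def)
  qed
qed

end
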